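(* Let $\{\mathcal{X}_1,\dots,\mathcal{X}_L\}$ be a finite set of $k$-dimensional linear subspaces of $\mathbb{R}^N$ (a finite set of points in the Grassmann manifold $\mathrm{Gr}(k,N)$) with $\mathcal{X}_i\cap\mathcal{X}_j=\{0\}$ for $i\ne j$, and consider the $\bar L:=L(L-1)/2$ sums $\mathcal{X}_i\oplus\mathcal{X}_j$, $i\neq j$. Let $0<C_s<1$ and $\varepsilon>0$ be constants, and let $\Phi\in\mathbb{R}^{M\times N}$ (with $2k\le M<N$) be a measurement matrix which satisfies the volume-preserving embedding property for all dimensions $1\le d\le 2k$, that is: for every $1\le d\le 2k$, every $1\le i\ne j\le L$, and every matrix $X=[x_1,\dots,x_d]\in\mathbb{R}^{N\times d}$ with $\|x_l\|_2=1$ $(1\le l\le d)$, $\mathrm{span}(X)\subset\mathcal{X}_i\oplus\mathcal{X}_j$ and $\mathrm{vol}_d(X)>C_s$, $$\left|\log\frac{\mathrm{vol}_d(\Phi X)}{\mathrm{vol}_d(X)}-\frac12\sum_{p=1}^{d}\Big(\psi[(M-p+1)/2]+\log2-\log M\Big)\right|\le\varepsilon .$$ Then, for all $1\le i\ne j\le L$, the principal angles $\pi/2\ge\theta_1(\mathcal{X}_i,\mathcal{X}_j)\ge\cdots\ge\theta_k(\mathcal{X}_i,\mathcal{X}_j)>0$ between $\mathcal{X}_i$ and $\mathcal{X}_j$ and the principal angles $\pi/2\ge\theta_1(\Phi\mathcal{X}_i,\Phi\mathcal{X}_j)\ge\cdots\ge\theta_k(\Phi\mathcal{X}_i,\Phi\mathcal{X}_j)>0$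 between $\Phi\mathcal{X}_i$ and $\Phi\mathcal{X}_j$ satisfy $$\left|\log\frac{\prod_{m=1}^k\sin\theta_m(\Phi\mathcal{X}_i,\Phi\mathcal{X}_j)}{\prod_{m=1}^k\sin\theta_m(\mathcal{X}_i,\mathcal{X}_j)}-\frac12\sum_{p=1}^{k}\Big(\psi[(M-p-k+1)/2]-\psi[(M-p+1)/2]\Big)\right|\le3\varepsilon .$$
   Context: For a matrix $A$ with $d$ columns, $\mathrm{vol}_d(A):=\sqrt{\det(A^TA)}$, and $\mathrm{span}(A)$ is the column space of $A$. For a subspace $\mathcal{X}$, $\Phi\mathcal{X}$ denotes its image under $\Phi$; it is assumed throughout that $\dim(\Phi\mathcal{X}_i)=\dim(\mathcal{X}_i)=k$ for all $i$. The principal angles between two $k$-dimensional subspaces with orthonormal bases $U,V$ are the arccosines of the singular values of $U^TV$. $\psi(x)=\frac{d}{dx}\log\Gamma(x)$ is the Digamma function. *)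

theory Defs
  imports "HOL-Analysis.Analysis" "Jordan_Normal_Form.Char_Poly"
begin

text \<open>
  A matrix whose number of columns varies is represented by the list of its columns, which are
  vectors of \<^typ>\<open>real ^ 'n\<close>. The product \<open>A\<^sup>T B\<close> of two such matrices is then the matrix of the
  inner products of their columns. The left factor \<open>\<Phi>\<close>, of fixed size, acts column by column.
\<close>

definition transpose_times :: "(real ^ 'n) list \<Rightarrow> (real ^ 'n) list \<Rightarrow> real Matrix.mat" where
  "transpose_times A B = Matrix.mat (length A) (length B) (\<lambda>(i, j). inner (A ! i) (B ! j))"

definition vol :: "(real ^ 'n) list \<Rightarrow> real" where
  "vol A = sqrt (Determinant.det (transpose_times A A))"

definition image_columns :: "real ^ 'n ^ 'm \<Rightarrow> (real ^ 'n) list \<Rightarrow> (real ^ 'm) list" where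
  "image_columns \<Phi> A = map (\<lambda>x. \<Phi> *v x) A"

definition orthonormal_basis :: "(real ^ 'n) list \<Rightarrow> (real ^ 'n) set \<Rightarrow> bool" where
  "orthonormal_basis U X \<longleftrightarrow> transpose_times U U = 1\<^sub>m (length U) \<and> span (set U) = X"

definition sum_subspace :: "'a::real_vector set \<Rightarrow> 'a set \<Rightarrow> 'a set" where
  "sum_subspace X Y = {x + y | x y. x \<in> X \<and> y \<in> Y}"

text \<open>
  The singular values of a square real matrix \<open>W\<close>, in decreasing order: the square roots of the
  eigenvalues of \<open>W\<^sup>T W\<close>, repeated according to multiplicity. As \<open>W\<^sup>T W\<close> is symmetric and positive
  semidefinite, its characteristic polynomial has as many real roots as its degree.
\<close>

definition singular_values :: "real Matrix.mat \<Rightarrow> real list" where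
  "singular_values W =
     rev (sorted_list_of_multiset
       (image_mset sqrt (proots (char_poly (transpose_mat W * W)))))"

text \<open>
  The choice of orthonormal bases is immaterial: another choice multiplies \<open>U\<^sup>T V\<close> on either side
  by an orthogonal matrix, which preserves the singular values. The angles are indexed from \<open>1\<close>,
  the largest coming first; the smallest singular value has the largest arccosine.
\<close>

definition principal_angles :: "(real ^ 'n) set \<Rightarrow> (real ^ 'n) set \<Rightarrow> real list" where
  "principal_angles X Y =
     (let U = (SOME U. orthonormal_basis U X); V = (SOME V. orthonormal_basis V Y)
      in map arccos (rev (singular_values (transpose_times U V))))"

definition principal_angle :: "nat \<Rightarrow> (real ^ 'n) set \<Rightarrow> (real ^ 'n) set \<Rightarrow> real" where
  "principal_angle m X Y = principal_angles X Y ! (m - 1)"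

text \<open>
  Since \<^const>\<open>ln\<close> is total with value \<open>0\<close> at \<open>0\<close>, the estimate on the logarithm needs the
  additional conjunct that \<open>\<Phi> A\<close> has positive volume (for volume \<open>0\<close> the logarithm is \<open>-\<infinity>\<close> and
  the estimate fails).
\<close>

definition volume_preserving_embedding ::
  "real ^ 'n ^ 'm \<Rightarrow> (real ^ 'n) set \<Rightarrow> nat \<Rightarrow> real \<Rightarrow> real \<Rightarrow> bool" where
  "volume_preserving_embedding \<Phi> W d C\<^sub>s \<epsilon> \<longleftrightarrow>
     (\<forall>A. length A = d \<and> (\<forall>x \<in> set A. norm x = 1) \<and> span (set A) \<subseteq> W \<and> vol A > C\<^sub>s \<longrightarrow>
        vol (image_columns \<Phi> A) > 0 \<and>
        \<bar>ln (vol (image_columns \<Phi> A) / vol A)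
           - 1/2 * (\<Sum>p = 1..d. Digamma ((real CARD('m) - real p + 1) / 2)
                                 + ln 2 - ln (real CARD('m)))\<bar> \<le> \<epsilon>)"

end

theory Submission
  imports Defs
begin

text \<open>
  If \<open>U\<close> and \<open>V\<close> are orthonormal bases of \<open>X\<close> and \<open>Y\<close>, the Gram determinant of \<open>[U, V]\<close> is
  \<open>det (1 - W\<^sup>T W)\<close> with \<open>W = U\<^sup>T V\<close>, so the volume of \<open>[U, V]\<close> is the product of the sines of
  the principal angles; for arbitrary bases it acquires the factors \<open>vol A\<close> and \<open>vol B\<close>.
  The volume of \<open>[U, V]\<close> may be too small for the embedding property, but \<open>\<Phi>\<close> scales the
  volumes of all bases of \<open>X \<oplus> Y\<close> by the same factor. Hence the quotient of the two products
  of sines is \<open>vol (\<Phi> Z) / (vol (\<Phi> U) vol (\<Phi> V))\<close> for an orthonormal basis \<open>Z\<close> of \<open>X \<oplus> Y\<close>, and the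
  embedding property applies to each of the three factors.
\<close>

section \<open>Matrices as column lists: products, Gram matrices, volumes\<close>

no_notation inner (infix "\<bullet>" 70)
no_notation vec_nth (infixl "$" 90)

text \<open>The product \<open>A c\<close> for the matrix with columns \<open>A\<close>. The
  coefficients form a vector of variable length, since no type fixes the number of columns.\<close>

definition combination :: "(real ^ 'n) list \<Rightarrow> real Matrix.vec \<Rightarrow> real ^ 'n" where
  "combination A c = (\<Sum>i<length A. (c $ i) *\<^sub>R A ! i)"

text \<open>The product \<open>A B\<close>, which serves for changes of basis: it acts from the
  right, while \<open>\<Phi>\<close> acts from the left.\<close>

definition columns_times :: "(real ^ 'n) list \<Rightarrow> real mat \<Rightarrow> (real ^ 'n) list" where
  "columns_times A B = map (\<lambda>j. combination A (col B j)) [0..<dim_col B]"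

lemma length_columns_times [simp]: "length (columns_times A B) = dim_col B"
  by (simp add: columns_times_def)

lemma nth_columns_times [simp]:
  "j < dim_col B \<Longrightarrow> columns_times A B ! j = combination A (col B j)"
  by (simp add: columns_times_def)

lemma transpose_times_carrier [simp]:
  "transpose_times A B \<in> carrier_mat (length A) (length B)"
  by (simp add: transpose_times_def)

lemma dim_transpose_times [simp]:
  "dim_row (transpose_times A B) = length A" "dim_col (transpose_times A B) = length B"
  by (simp_all add: transpose_times_def)

lemma index_transpose_times [simp]:
  "i < length A \<Longrightarrow> j < length B \<Longrightarrow> transpose_times A B $$ (i, j) = inner (A ! i) (B ! j)"
  by (simp add: transpose_times_def)

lemma transpose_transpose_times: "(transpose_times A B)\<^sup>T = transpose_times B A"
  by (rule eq_matI) (simp_all add: inner_commute)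

lemma index_transpose_times_mult_vec:
  assumes "c \<in> carrier_vec (length B)" "i < length A"
  shows "(transpose_times A B *\<^sub>v c) $ i = inner (A ! i) (combination B c)"
  using assms
  by (auto simp: combination_def inner_sum_right scalar_prod_def atLeast0LessThan mult.commute
      intro!: sum.cong)

lemma transpose_times_columns_times_right:
  assumes "B \<in> carrier_mat (length A) m"
  shows "transpose_times C (columns_times A B) = transpose_times C A * B"
proof (rule eq_matI)
  fix i j assume "i < dim_row (transpose_times C A * B)" "j < dim_col (transpose_times C A * B)"
  then have ij: "i < length C" "j < dim_col B" by auto
  then have "(transpose_times C A * B) $$ (i, j) = (transpose_times C A *\<^sub>v col B j) $ i"
    by simp
  also have "\<dots> = inner (C ! i) (combination A (col B j))"
    using assms ij by (intro index_transpose_times_mult_vec) auto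
  finally show "transpose_times C (columns_times A B) $$ (i, j) = (transpose_times C A * B) $$ (i, j)"
    using ij by simp
qed auto

lemma transpose_times_columns_times_left:
  assumes "B \<in> carrier_mat (length A) m"
  shows "transpose_times (columns_times A B) C = B\<^sup>T * transpose_times A C"
proof -
  have "transpose_times (columns_times A B) C = (transpose_times C A * B)\<^sup>T"
    by (metis assms transpose_transpose_times transpose_times_columns_times_right)
  also have "\<dots> = B\<^sup>T * transpose_times A C"
    by (metis assms transpose_mult transpose_times_carrier transpose_transpose_times)
  finally show ?thesis .
qed

text \<open>The Gram matrix of \<open>A B\<close> is \<open>B^T (A^T A) B\<close>, and the
  determinant is multiplicative on these square factors.\<close>

lemma vol_columns_times:
  assumes B: "B \<in> carrier_mat (length A) (length A)"
  shows "vol (columns_times A B) = \<bar>Determinant.det B\<bar> * vol A"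
proof -
  have "transpose_times (columns_times A B) (columns_times A B)
      = B\<^sup>T * (transpose_times A A * B)"
    using B by (simp add: transpose_times_columns_times_left transpose_times_columns_times_right
        assoc_mult_mat[of _ "length A" "length A" _ "length A" _ "length A"])
  also have "Determinant.det \<dots> = (Determinant.det B)\<^sup>2 * Determinant.det (transpose_times A A)"
    using B
    by (simp add: det_mult[OF _ mult_carrier_mat[OF transpose_times_carrier B]]
        det_mult[OF transpose_times_carrier B] det_transpose[OF B] power2_eq_square)
  finally show ?thesis by (simp add: vol_def real_sqrt_mult)
qed

text \<open>Linearity in each column. A change of basis therefore affects volumes before and after
  \<open>\<Phi>\<close> by the same determinant.\<close>

lemma image_columns_columns_times:
  assumes "B \<in> carrier_mat (length A) m"
  shows "image_columns \<Phi> (columns_times A B) = columns_times (image_columns \<Phi> A) B"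
  using assms
  by (auto simp: image_columns_def columns_times_def combination_def
      matrix_vector_mult_scaleR linear_sum[OF matrix_vector_mul_linear] intro!: sum.cong)

text \<open>Each column of the block diagonal matrix has zero coefficients on one of the two lists,
  so it combines vectors of the other list only.\<close>

lemma columns_times_append:
  assumes P: "P \<in> carrier_mat (length A) m" and Q: "Q \<in> carrier_mat (length B) n"
  shows "columns_times A P @ columns_times B Q
    = columns_times (A @ B) (four_block_mat P (0\<^sub>m (length A) n) (0\<^sub>m (length B) m) Q)"
    (is "_ = columns_times _ ?D")
proof (rule nth_equalityI)
  fix j assume "j < length (columns_times A P @ columns_times B Q)"
  then have j: "j < m + n" using P Q by simp
  have split: "combination (A @ B) c = combination A (vec_first c (length A))
      + combination B (vec_last c (length B))" if c: "c \<in> carrier_vec (length A + length B)" for c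
  proof -
    have "combination (A @ B) c = (\<Sum>i\<in>{0..<length A + length B}. (c $ i) *\<^sub>R (A @ B) ! i)"
      by (simp add: combination_def atLeast0LessThan)
    also have "\<dots> = (\<Sum>i\<in>{0..<length A}. (c $ i) *\<^sub>R (A @ B) ! i)
        + (\<Sum>i\<in>{length A..<length A + length B}. (c $ i) *\<^sub>R (A @ B) ! i)"
      by (simp add: sum.atLeastLessThan_concat)
    also have "(\<Sum>i\<in>{length A..<length A + length B}. (c $ i) *\<^sub>R (A @ B) ! i)
        = (\<Sum>i<length B. (c $ (length A + i)) *\<^sub>R B ! i)"
      using sum.shift_bounds_nat_ivl[of "\<lambda>i. (c $ i) *\<^sub>R (A @ B) ! i" 0 "length A" "length B"]
      by (simp add: atLeast0LessThan add.commute nth_append)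
    finally show ?thesis
      using c by (simp add: combination_def vec_first_def vec_last_def atLeast0LessThan nth_append)
  qed
  have combination_0: "combination C (0\<^sub>v (length C)) = 0" for C :: "(real ^ 'n) list"
    by (simp add: combination_def)
  have col_left: "vec_first (col ?D j) (length A) = (if j < m then col P j else 0\<^sub>v (length A))"
    using j P Q by (intro eq_vecI) (auto simp: vec_first_def)
  have col_right: "vec_last (col ?D j) (length B) = (if j < m then 0\<^sub>v (length B) else col Q (j - m))"
    using j P Q by (intro eq_vecI) (auto simp: vec_last_def)
  have "col ?D j \<in> carrier_vec (length A + length B)"
    using P Q by (intro carrier_vecI) simp
  then have "combination (A @ B) (col ?D j)
      = (if j < m then combination A (col P j) else combination B (col Q (j - m)))"
    by (simp add: split col_left col_right combination_0)
  then show "(columns_times A P @ columns_times B Q) ! j = columns_times (A @ B) ?D ! j"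
    using j P Q by (simp add: nth_append)
qed (use P Q in auto)

lemma vol_append_columns_times:
  assumes P: "P \<in> carrier_mat (length A) (length A)" and Q: "Q \<in> carrier_mat (length B) (length B)"
  shows "vol (columns_times A P @ columns_times B Q)
    = \<bar>Determinant.det P\<bar> * \<bar>Determinant.det Q\<bar> * vol (A @ B)"
  using P Q
  by (simp add: columns_times_append vol_columns_times abs_mult
      det_four_block_mat_lower_left_zero[OF P _ refl Q])

section \<open>Orthonormal bases as lists\<close>

lemma inner_orthonormal:
  assumes "transpose_times U U = 1\<^sub>m (length U)" "i < length U" "j < length U"
  shows "inner (U ! i) (U ! j) = (if i = j then 1 else 0)"
  using arg_cong[OF assms(1), of "\<lambda>M. M $$ (i, j)"] assms(2,3) by simp

lemma vol_orthonormal: "transpose_times U U = 1\<^sub>m (length U) \<Longrightarrow> vol U = 1"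
  by (simp add: vol_def)

lemma norm_orthonormal:
  assumes "transpose_times U U = 1\<^sub>m (length U)" "x \<in> set U"
  shows "norm x = 1"
  using assms inner_orthonormal[OF assms(1)] by (auto simp: in_set_conv_nth norm_eq_1)

text \<open>The difference of \<open>x\<close> and its projection lies in the span and is orthogonal
  to every vector of \<open>U\<close>, hence to itself.\<close>

lemma orthonormal_expansion:
  assumes U: "transpose_times U U = 1\<^sub>m (length U)" and x: "x \<in> span (set U)"
  shows "(\<Sum>i<length U. inner (U ! i) x *\<^sub>R U ! i) = x"
proof -
  let ?p = "\<Sum>i<length U. inner (U ! i) x *\<^sub>R U ! i"
  have "?p \<in> span (set U)"
    by (intro span_sum span_scale span_base) simp
  then have in_span: "x - ?p \<in> span (set U)"
    using x by (rule span_diff[rotated])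
  have "inner (U ! j) (x - ?p) = 0" if "j < length U" for j
  proof -
    have "inner (U ! j) ?p = (\<Sum>i<length U. if i = j then inner (U ! j) x else 0)"
      unfolding inner_sum_right
      by (rule sum.cong) (use that in \<open>auto simp: inner_orthonormal[OF U]\<close>)
    then show ?thesis using that by (simp add: inner_diff_right)
  qed
  then have "real_inner_class.orthogonal (x - ?p) y" if "y \<in> set U" for y
    using that by (auto simp: real_inner_class.orthogonal_def in_set_conv_nth inner_commute[of "x - ?p"])
  then have "real_inner_class.orthogonal (x - ?p) (x - ?p)"
    by (rule orthogonal_to_span[OF in_span])
  then show ?thesis by (simp add: real_inner_class.orthogonal_def)
qed

text \<open>The entries of \<open>U^T A\<close> are the coefficients in the expansions of the
  columns. Every list in the span thus is \<open>U\<close> times an explicit matrix, to which the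
  determinant rules apply.\<close>

lemma columns_times_transpose_times:
  assumes U: "transpose_times U U = 1\<^sub>m (length U)" and A: "set A \<subseteq> span (set U)"
  shows "columns_times U (transpose_times U A) = A"
proof (rule nth_equalityI)
  fix j assume "j < length (columns_times U (transpose_times U A))"
  then have j: "j < length A" by simp
  then have "A ! j \<in> span (set U)" using A by auto
  from orthonormal_expansion[OF U this] j
  show "columns_times U (transpose_times U A) ! j = A ! j"
    by (simp add: combination_def)
qed simp

lemma combination_in_span: "combination A c \<in> span (set A)"
  unfolding combination_def by (intro span_sum span_scale span_base) simp

lemma obtain_orthonormal_basis:
  assumes "subspace S"
  obtains U where "orthonormal_basis U S"
proof -
  obtain B where B: "pairwise real_inner_class.orthogonal B" "\<And>x. x \<in> B \<Longrightarrow> norm x = 1" "independent B" "span B = S"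
    using orthonormal_basis_subspace[OF assms] by metis
  obtain U where U: "set U = B" "distinct U"
    using finite_distinct_list independent_imp_finite[OF B(3)] by blast
  have "transpose_times U U = 1\<^sub>m (length U)"
  proof (rule eq_matI)
    fix i j assume "i < dim_row (1\<^sub>m (length U) :: real mat)" "j < dim_col (1\<^sub>m (length U) :: real mat)"
    then have ij: "i < length U" "j < length U" by auto
    show "transpose_times U U $$ (i, j) = 1\<^sub>m (length U) $$ (i, j)"
    proof (cases "i = j")
      case True
      then show ?thesis using ij U B(2)[of "U ! i"] by (auto simp: norm_eq_1)
    next
      case False
      then have "U ! i \<noteq> U ! j" using U(2) ij by (simp add: nth_eq_iff_index_eq)
      then show ?thesis using False ij U B(1) by (auto simp: pairwise_def real_inner_class.orthogonal_def)
    qed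
  qed auto
  then have "orthonormal_basis U S"
    using U(1) B(4) by (simp add: orthonormal_basis_def)
  then show ?thesis by (rule that)
qed

text \<open>A repeated vector would put a 1 off the diagonal of the Gram matrix, so the list is
  distinct; orthogonal unit vectors are independent.\<close>

lemma length_orthonormal_basis:
  assumes "orthonormal_basis U S"
  shows "length U = dim S"
proof -
  have U: "transpose_times U U = 1\<^sub>m (length U)" and span: "span (set U) = S"
    using assms by (auto simp: orthonormal_basis_def)
  have "distinct U"
    using inner_orthonormal[OF U] by (metis distinct_conv_nth zero_neq_one)
  moreover have "pairwise real_inner_class.orthogonal (set U)"
    by (auto simp: pairwise_def real_inner_class.orthogonal_def in_set_conv_nth inner_orthonormal[OF U] split: if_splits)
  then have "independent (set U)"
    using norm_orthonormal[OF U] by (intro pairwise_orthogonal_independent) force+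
  ultimately show ?thesis
    using span dim_span_eq_card_independent distinct_card by metis
qed

section \<open>Spectra of Gram matrices and the volume of two joined orthonormal bases\<close>

text \<open>Over the complex numbers the characteristic polynomial splits. An eigenvector
  \<open>v\<close> for \<open>e\<close> gives \<open>e |v|^2 = |W v|^2\<close>, so \<open>e\<close>
  is real and nonnegative, and the factorization descends to the reals.\<close>

lemma char_poly_gram_factorized:
  fixes W :: "real mat"
  assumes W: "W \<in> carrier_mat a b"
  obtains es where "char_poly (W\<^sup>T * W) = (\<Prod>e\<leftarrow>es. [:- e, 1:])" "length es = b"
    "\<forall>e\<in>set es. 0 \<le> e"
proof -
  let ?c = "map_mat complex_of_real"
  let ?M = "?c (W\<^sup>T * W)"
  have G: "W\<^sup>T * W \<in> carrier_mat b b" using W by simp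
  then have M: "?M \<in> carrier_mat b b" by simp
  have cW: "?c W \<in> carrier_mat a b" using W by simp
  obtain es where es: "char_poly ?M = (\<Prod>e\<leftarrow>es. [:- e, 1:])" "length es = b"
    using char_poly_factorized[OF M] by auto
  have nonneg: "0 \<le> e" if "e \<in> set es" for e
  proof -
    have "poly (char_poly ?M) e = 0"
      using that by (auto simp: es poly_prod_list prod_list_zero_iff)
    then have "eigenvalue ?M e" using eigenvalue_root_char_poly[OF M] by simp
    then obtain v where v: "v \<in> carrier_vec b" "v \<noteq> 0\<^sub>v b" "?M *\<^sub>v v = e \<cdot>\<^sub>v v"
      using M by (auto simp: eigenvalue_def eigenvector_def)
    have MW: "?M = (?c W)\<^sup>T * ?c W"
      using W of_real_hom.mat_hom_mult[of "W\<^sup>T" b a W b] by (simp add: map_mat_transpose)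
    \<comment> \<open>The entries of \<open>W\<close> are real, so conjugation passes through and
      the transpose acts as the adjoint.\<close>
    have conj: "?c W *\<^sub>v conjugate v = conjugate (?c W *\<^sub>v v)"
      using W v by (intro eq_vecI) (auto simp: scalar_prod_def conjugate_complex_def)
    have "e * (v \<bullet>c v) = (?M *\<^sub>v v) \<bullet>c v"
      using v by simp
    also have "\<dots> = ((?c W)\<^sup>T *\<^sub>v (?c W *\<^sub>v v)) \<bullet>c v"
      using v cW by (simp add: MW assoc_mult_mat_vec[of _ b a _ b])
    also have "\<dots> = (?c W *\<^sub>v v) \<bullet>c (?c W *\<^sub>v v)"
      using v cW conj by (subst transpose_vec_mult_scalar[of _ a b]) auto
    finally have "e * (v \<bullet>c v) \<ge> 0"
      using conjugate_square_ge_0_vec by metis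
    moreover have "v \<bullet>c v > 0"
      using v conjugate_square_greater_0_vec by blast
    \<comment> \<open>In the order on complex numbers this also says that the imaginary part of
      \<open>e\<close> is 0.\<close>
    ultimately show "0 \<le> e"
      by (auto simp: less_eq_complex_def less_complex_def zero_le_mult_iff)
  qed
  let ?rs = "map Re es"
  interpret h: map_poly_inj_idom_hom complex_of_real ..
  have "complex_of_real (Re e) = e" if "e \<in> set es" for e
    using nonneg[OF that] by (simp add: complex_eq_iff less_eq_complex_def)
  then have "map_poly complex_of_real (\<Prod>e\<leftarrow>?rs. [:- e, 1:]) = (\<Prod>e\<leftarrow>es. [:- e, 1:])"
    by (induction es) (simp_all add: h.hom_mult map_poly_pCons del: mult_pCons_left)
  also have "\<dots> = map_poly complex_of_real (char_poly (W\<^sup>T * W))"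
    using es of_real_hom.char_poly_hom[OF G, where 'a=complex] by simp
  finally have "char_poly (W\<^sup>T * W) = (\<Prod>e\<leftarrow>?rs. [:- e, 1:])"
    by (simp add: h.eq_iff)
  then show ?thesis
    using that[of ?rs] es nonneg by (auto simp: less_eq_complex_def)
qed

text \<open>\<open>det (1 - A)\<close> is the value of the characteristic polynomial at 1; since
  \<open>char_matrix A 1\<close> is \<open>A - 1\<close>, a sign appears.\<close>

lemma det_one_minus_char_poly:
  assumes "A \<in> carrier_mat n n" "char_poly A = (\<Prod>e\<leftarrow>es. [:- e, 1:])"
  shows "Determinant.det (1\<^sub>m n - A) = (\<Prod>e\<leftarrow>es. 1 - e :: real)"
proof -
  have "- char_matrix A 1 = 1\<^sub>m n - A"
    using assms(1) by (intro eq_matI) (auto simp: char_matrix_def)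
  then have "Determinant.det (1\<^sub>m n - A) = poly (char_poly A) 1"
    using char_poly_matrix[OF assms(1), of 1] by simp
  then show ?thesis
    by (simp add: assms(2) poly_prod_list o_def)
qed

text \<open>Block elimination with a Schur complement: a right factor of determinant 1 clears the
  block \<open>W\<close> and leaves a block lower triangular matrix.\<close>

lemma det_four_block_one:
  fixes W :: "real mat"
  assumes W: "W \<in> carrier_mat a b" and C: "C \<in> carrier_mat b a"
  shows "Determinant.det (four_block_mat (1\<^sub>m a) W C (1\<^sub>m b)) = Determinant.det (1\<^sub>m b - C * W)"
proof -
  let ?E = "four_block_mat (1\<^sub>m a) (- W) (0\<^sub>m b a) (1\<^sub>m b)"
  let ?F = "four_block_mat (1\<^sub>m a) W C (1\<^sub>m b)"
  have F: "?F \<in> carrier_mat (a + b) (a + b)" and E: "?E \<in> carrier_mat (a + b) (a + b)"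
    using W C by auto
  have "?F * ?E = four_block_mat (1\<^sub>m a) (0\<^sub>m a b) C (1\<^sub>m b - C * W)"
    using W C
    by (subst mult_four_block_mat[of _ a a _ b _ b _ _ a _ b])
      (auto intro!: cong_four_block_mat eq_matI)
  then have "Determinant.det ?F * Determinant.det ?E = Determinant.det (1\<^sub>m b - C * W)"
    using mult_carrier_mat[OF C W] C
      det_four_block_mat_upper_right_zero[of "1\<^sub>m a" a "0\<^sub>m a b" b C "1\<^sub>m b - C * W"]
    by (simp add: det_mult[OF F E, symmetric] minus_carrier_mat)
  moreover have "Determinant.det ?E = 1"
    using W by (simp add: det_four_block_mat_lower_left_zero[of _ a _ b])
  ultimately show ?thesis by simp
qed

lemma vol_append_orthonormal:
  assumes U: "transpose_times U U = 1\<^sub>m (length U)" and V: "transpose_times V V = 1\<^sub>m (length V)"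
  defines "W \<equiv> transpose_times U V"
  shows "vol (U @ V) = sqrt (Determinant.det (1\<^sub>m (length V) - W\<^sup>T * W))"
proof -
  have "transpose_times (U @ V) (U @ V)
      = four_block_mat (transpose_times U U) W W\<^sup>T (transpose_times V V)"
    by (rule eq_matI) (auto simp: nth_append W_def transpose_transpose_times)
  then show ?thesis
    using det_four_block_one[of W "length U" "length V" "W\<^sup>T"]
    by (simp add: vol_def U V W_def transpose_transpose_times)
qed

lemma inner_combination_orthonormal:
  assumes U: "transpose_times U U = 1\<^sub>m (length U)" and c: "c \<in> carrier_vec (length U)"
  shows "inner (combination U c) (combination U c) = c \<bullet> c"
proof -
  have "inner (U ! i) (combination U c) = c $ i" if "i < length U" for i
    using index_transpose_times_mult_vec[OF c that, symmetric] U c by simp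
  then show ?thesis
    using c by (subst (1) combination_def)
      (simp add: inner_sum_left scalar_prod_def atLeast0LessThan)
qed

text \<open>A cosine of 1 would yield a common vector. Let \<open>y\<close> in \<open>Y\<close> have
  an eigenvector as coordinates, and let \<open>p\<close> be its projection to \<open>X\<close>.
  Then \<open>|p|^2 = e |y|^2\<close> and \<open>|y - p|^2 = (1 - e) |y|^2\<close>, so
  \<open>e \<ge> 1\<close> forces \<open>y = p\<close> in \<open>X \<inter> Y\<close>.\<close>

lemma eigenvalue_less_1:
  assumes U: "orthonormal_basis U X" and V: "orthonormal_basis V Y" and XY: "X \<inter> Y = {0}"
    and ev: "eigenvalue ((transpose_times U V)\<^sup>T * transpose_times U V) e"
  shows "e < 1"
proof (rule ccontr)
  assume "\<not> e < 1"
  let ?W = "transpose_times U V"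
  have UU: "transpose_times U U = 1\<^sub>m (length U)" and X: "span (set U) = X"
    and VV: "transpose_times V V = 1\<^sub>m (length V)" and Y: "span (set V) = Y"
    using U V by (auto simp: orthonormal_basis_def)
  obtain v where v: "v \<in> carrier_vec (length V)" "v \<noteq> 0\<^sub>v (length V)" "?W\<^sup>T * ?W *\<^sub>v v = e \<cdot>\<^sub>v v"
    using ev by (auto simp: eigenvalue_def eigenvector_def)
  define y where "y = combination V v"
  \<comment> \<open>As \<open>W v = U^T y\<close>, these are the coordinates of the orthogonal
    projection of \<open>y\<close> onto \<open>X\<close>.\<close>
  define c where "c = ?W *\<^sub>v v"
  define p where "p = combination U c"
  have c: "c \<in> carrier_vec (length U)"
    using mult_mat_vec_carrier[OF transpose_times_carrier v(1)] by (simp add: c_def)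
  have ci: "c $ i = inner (U ! i) y" if "i < length U" for i
    using index_transpose_times_mult_vec[OF v(1) that] by (simp add: c_def y_def)
  have yy: "inner y y = v \<bullet> v" and pp: "inner p p = c \<bullet> c"
    using inner_combination_orthonormal[OF VV v(1)] inner_combination_orthonormal[OF UU c]
    by (simp_all add: y_def p_def)
  have py: "inner p y = c \<bullet> c"
    using c by (simp add: p_def combination_def inner_sum_left scalar_prod_def atLeast0LessThan ci)
  have "c \<bullet> c = (?W\<^sup>T *\<^sub>v c) \<bullet> v"
    using v c by (subst transpose_vec_mult_scalar[of _ "length U" "length V"]) (auto simp: c_def)
  also have "?W\<^sup>T *\<^sub>v c = e \<cdot>\<^sub>v v"
    using v by (simp add: c_def assoc_mult_mat_vec[of _ "length V" "length U" _ "length V", symmetric])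
  finally have "c \<bullet> c = e * inner y y"
    using v by (simp add: yy)
  moreover have "inner y y \<le> e * inner y y"
    using \<open>\<not> e < 1\<close> mult_right_mono[of 1 e "inner y y"] by simp
  moreover have "inner (y - p) (y - p) = inner y y - c \<bullet> c"
    by (simp add: inner_diff_left inner_diff_right py pp inner_commute[of y p])
  ultimately have "inner (y - p) (y - p) \<le> 0" by simp
  then have "y = p"
    by (metis eq_iff_diff_eq_0 inner_gt_zero_iff linorder_not_less)
  then have "y \<in> X \<inter> Y"
    using combination_in_span[of U c] combination_in_span[of V v] X Y
    by (auto simp: y_def p_def)
  then have "v \<bullet> v = 0" using XY yy by simp
  then show False
    using v conjugate_square_eq_0_vec[of v "length V"] by simp
qed

section \<open>Principal angles and volumes\<close>

text \<open>The cosines are \<open>sqrt e\<close> for the eigenvalues \<open>0 \<le> e < 1\<close>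
  of \<open>W^T W\<close>, so the sines are \<open>sqrt (1 - e)\<close> and their product is the
  root of \<open>det (1 - W^T W)\<close>. The bases obtained are those chosen inside
  \<open>principal_angles\<close>.\<close>

lemma principal_angles_properties:
  fixes X Y :: "(real ^ 'n) set"
  assumes X: "subspace X" and Y: "subspace Y" and XY: "X \<inter> Y = {0}"
  obtains U V where "orthonormal_basis U X" "orthonormal_basis V Y"
    "length (principal_angles X Y) = dim Y"
    "sorted_wrt (\<ge>) (principal_angles X Y)"
    "\<forall>t\<in>set (principal_angles X Y). 0 < t \<and> t \<le> pi / 2"
    "(\<Prod>t\<leftarrow>principal_angles X Y. sin t) = vol (U @ V)"
proof -
  define U where "U = (SOME U. orthonormal_basis U X)"
  define V where "V = (SOME V. orthonormal_basis V Y)"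
  have U: "orthonormal_basis U X" and V: "orthonormal_basis V Y"
    unfolding U_def V_def using obtain_orthonormal_basis X Y by (metis someI)+
  define W where "W = transpose_times U V"
  have W: "W \<in> carrier_mat (length U) (length V)" by (simp add: W_def)
  obtain es where es: "char_poly (W\<^sup>T * W) = (\<Prod>e\<leftarrow>es. [:- e, 1:])" "length es = length V"
    "\<forall>e\<in>set es. 0 \<le> e"
    using char_poly_gram_factorized[OF W] .
  have G: "W\<^sup>T * W \<in> carrier_mat (length V) (length V)" using W by simp
  have less_1: "e < 1" if "e \<in> set es" for e
  proof (rule eigenvalue_less_1[OF U V XY])
    have "poly (char_poly (W\<^sup>T * W)) e = 0"
      using that by (auto simp: es poly_prod_list prod_list_zero_iff)
    then show "eigenvalue ((transpose_times U V)\<^sup>T * transpose_times U V) e"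
      using eigenvalue_root_char_poly[OF G] by (simp add: W_def)
  qed
  have roots: "proots (char_poly (W\<^sup>T * W)) = mset es"
  proof -
    have "proots (\<Prod>e\<leftarrow>es. [:- e, 1:]) = mset es"
    proof (induction es)
      case (Cons e es)
      have "(\<Prod>e\<leftarrow>es. [:- e, 1:]) \<noteq> 0" by (auto simp: prod_list_zero_iff)
      then show ?case
        using Cons proots_mult[of "[:- e, 1:]" "\<Prod>e\<leftarrow>es. [:- e, 1:]"]
        by (simp del: mult_pCons_left)
    qed simp
    then show ?thesis by (simp add: es)
  qed
  \<comment> \<open>The two reversals in the definitions cancel: increasing cosines already yield
    decreasing angles.\<close>
  have angles: "principal_angles X Y = map arccos (sort (map sqrt es))"
    unfolding principal_angles_def Let_def U_def[symmetric] V_def[symmetric] W_def[symmetric]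
      singular_values_def roots
    by (simp flip: mset_map)
  have sv: "0 \<le> s \<and> s < 1" if "s \<in> set (sort (map sqrt es))" for s
    using that es(3) less_1 by auto
  have "arccos t \<le> arccos s"
    if "s \<in> set (sort (map sqrt es))" "t \<in> set (sort (map sqrt es))" "s \<le> t" for s t
    using sv[OF that(1)] sv[OF that(2)] that(3) by (intro arccos_le_arccos) auto
  then have "sorted_wrt (\<ge>) (principal_angles X Y)"
    unfolding angles sorted_wrt_map
    by (rule sorted_wrt_mono_rel[OF _ sorted_sort[of "map sqrt es"]])
  moreover have "0 < t \<and> t \<le> pi / 2" if t: "t \<in> set (principal_angles X Y)" for t
  proof -
    obtain s where "t = arccos s" "s \<in> set (sort (map sqrt es))"
      using t unfolding angles set_map by blast
    moreover from this(2) have "0 \<le> s" "s < 1" using sv by blast+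
    ultimately have s: "t = arccos s" "0 \<le> s" "s < 1" by auto
    show ?thesis
      using arccos_less_arccos[of s 1] arccos_le_arccos[of 0 s] s by simp
  qed
  moreover have "(\<Prod>t\<leftarrow>principal_angles X Y. sin t) = vol (U @ V)"
  proof -
    have "(sin \<circ> arccos) s = sqrt (1 - s\<^sup>2)" if "s \<in> set (sort (map sqrt es))" for s
      using sv[OF that] by (simp add: sin_arccos)
    moreover have prod_list_sort: "prod_list (map f (sort xs)) = prod_list (map f xs)"
      for f :: "real \<Rightarrow> real" and xs
      by (simp flip: prod_mset_prod_list)
    ultimately have "(\<Prod>t\<leftarrow>principal_angles X Y. sin t) = (\<Prod>s\<leftarrow>sort (map sqrt es). sqrt (1 - s\<^sup>2))"
      unfolding angles map_map
      by (intro arg_cong[of _ _ prod_list] map_cong refl)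
    also have "\<dots> = (\<Prod>s\<leftarrow>map sqrt es. sqrt (1 - s\<^sup>2))"
      by (rule prod_list_sort)
    also have "\<dots> = (\<Prod>e\<leftarrow>es. sqrt (1 - e))"
      unfolding map_map using es(3)
      by (intro arg_cong[of _ _ prod_list] map_cong refl) auto
    also have "\<dots> = sqrt (\<Prod>e\<leftarrow>es. 1 - e)"
      by (induction es) (auto simp: real_sqrt_mult)
    also have "\<dots> = vol (U @ V)"
      using U V det_one_minus_char_poly[OF G es(1)]
      by (simp add: orthonormal_basis_def vol_append_orthonormal W_def)
    finally show ?thesis .
  qed
  moreover have "length (principal_angles X Y) = dim Y"
    by (simp add: angles es length_orthonormal_basis[OF V])
  ultimately show ?thesis using that U V by metis
qed

text \<open>Passes from list positions, counted from 0, to angles numbered from 1. The volume is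
  positive because the sine is positive at each angle.\<close>

lemma principal_angle_properties:
  fixes X Y :: "(real ^ 'n) set"
  assumes "subspace X" "subspace Y" "X \<inter> Y = {0}" and k: "dim Y = k"
  obtains U V where "orthonormal_basis U X" "orthonormal_basis V Y"
    "length (principal_angles X Y) = k"
    "\<forall>m\<in>{1..k}. 0 < principal_angle m X Y \<and> principal_angle m X Y \<le> pi / 2"
    "antimono_on {1..k} (\<lambda>m. principal_angle m X Y)"
    "(\<Prod>m = 1..k. sin (principal_angle m X Y)) = vol (U @ V)"
    "0 < vol (U @ V)"
proof -
  let ?\<theta> = "principal_angles X Y"
  obtain U V where UV: "orthonormal_basis U X" "orthonormal_basis V Y"
    and len: "length ?\<theta> = k" and sorted: "sorted_wrt (\<ge>) ?\<theta>"
    and bounds: "\<forall>t\<in>set ?\<theta>. 0 < t \<and> t \<le> pi / 2"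
    and prod: "(\<Prod>t\<leftarrow>?\<theta>. sin t) = vol (U @ V)"
    using principal_angles_properties[OF assms(1-3)] k by metis
  have angle: "0 < principal_angle m X Y \<and> principal_angle m X Y \<le> pi / 2" if "m \<in> {1..k}" for m
    unfolding principal_angle_def using that len bounds nth_mem[of "m - 1" ?\<theta>] by auto
  have "antimono_on {1..k} (\<lambda>m. principal_angle m X Y)"
  proof (rule monotone_onI)
    fix l m assume "l \<in> {1..k}" "m \<in> {1..k}" "l \<le> m"
    then show "principal_angle m X Y \<le> principal_angle l X Y"
      using sorted_wrt_nth_less[OF sorted, of "l - 1" "m - 1"] len
      by (cases "l = m") (auto simp: principal_angle_def)
  qed
  moreover have "(\<Prod>m = 1..k. sin (principal_angle m X Y)) = vol (U @ V)"
  proof -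
    have "vol (U @ V) = (\<Prod>i = 0..<k. sin (?\<theta> ! i))"
      by (simp flip: prod add: prod.list_conv_set_nth len)
    also have "\<dots> = (\<Prod>m = 1..k. sin (principal_angle m X Y))"
      by (rule prod.reindex_bij_witness[of _ "\<lambda>m. m - 1" Suc]) (auto simp: principal_angle_def)
    finally show ?thesis by simp
  qed
  moreover have "0 < (\<Prod>m = 1..k. sin (principal_angle m X Y))"
  proof (rule prod_pos)
    fix m assume "m \<in> {1..k}"
    from angle[OF this] show "0 < sin (principal_angle m X Y)"
      using pi_gt_zero by (intro sin_gt_zero) linarith+
  qed
  ultimately show ?thesis
    using that[OF UV len] angle by simp
qed

section \<open>Volumes and intersections under \<open>\<Phi>\<close>\<close>

text \<open>With \<open>A = Z B\<close> for the square matrix \<open>B = Z^T A\<close>, both volumes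
  acquire the factor \<open>|det B|\<close>, and \<open>vol Z = 1\<close>. So one scaling factor
  serves all volumes of full dimension in \<open>S\<close>.\<close>

lemma vol_image_columns:
  assumes Z: "orthonormal_basis Z S" and A: "set A \<subseteq> S" "length A = length Z"
  shows "vol (image_columns \<Phi> A) = vol (image_columns \<Phi> Z) * vol A"
proof -
  have ZZ: "transpose_times Z Z = 1\<^sub>m (length Z)" and S: "span (set Z) = S"
    using Z by (auto simp: orthonormal_basis_def)
  define B where "B = transpose_times Z A"
  have B: "B \<in> carrier_mat (length Z) (length Z)" using A by (metis B_def transpose_times_carrier)
  have eq: "A = columns_times Z B"
    using columns_times_transpose_times[OF ZZ] A(1) S by (simp add: B_def)
  have "length (image_columns \<Phi> Z) = length Z" by (simp add: image_columns_def)
  then show ?thesis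
    using B by (simp add: eq image_columns_columns_times vol_columns_times vol_orthonormal[OF ZZ])
qed

text \<open>With \<open>A = U P\<close> and \<open>B = V Q\<close>, the determinants of
  \<open>P\<close> and \<open>Q\<close> are up to sign the volumes of \<open>A\<close> and
  \<open>B\<close>.\<close>

lemma vol_append:
  assumes U: "orthonormal_basis U X" and V: "orthonormal_basis V Y"
    and A: "set A \<subseteq> X" "length A = length U" and B: "set B \<subseteq> Y" "length B = length V"
  shows "vol (A @ B) = vol A * vol B * vol (U @ V)"
proof -
  have UU: "transpose_times U U = 1\<^sub>m (length U)" and X: "span (set U) = X"
    and VV: "transpose_times V V = 1\<^sub>m (length V)" and Y: "span (set V) = Y"
    using U V by (auto simp: orthonormal_basis_def)
  define P where "P = transpose_times U A"
  define Q where "Q = transpose_times V B"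
  have P: "P \<in> carrier_mat (length U) (length U)" and Q: "Q \<in> carrier_mat (length V) (length V)"
    using A B by (metis P_def Q_def transpose_times_carrier)+
  have "A = columns_times U P" "B = columns_times V Q"
    using columns_times_transpose_times[OF UU] columns_times_transpose_times[OF VV] A B X Y
    by (simp_all add: P_def Q_def)
  then show ?thesis
    using P Q by (simp add: vol_append_columns_times vol_columns_times vol_orthonormal UU VV)
qed

text \<open>The Gram matrix of \<open>\<Phi> Z\<close> annihilates the coordinates of
  \<open>x\<close>, and its determinant is nonzero.\<close>

lemma matrix_injective_if_vol_pos:
  assumes Z: "orthonormal_basis Z S" and pos: "0 < vol (image_columns \<Phi> Z)"
    and x: "x \<in> S" "\<Phi> *v x = 0"
  shows "x = 0"
proof -
  have ZZ: "transpose_times Z Z = 1\<^sub>m (length Z)" and S: "span (set Z) = S"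
    using Z by (auto simp: orthonormal_basis_def)
  let ?G = "transpose_times (image_columns \<Phi> Z) (image_columns \<Phi> Z)"
  define c where "c = Matrix.vec (length Z) (\<lambda>i. inner (Z ! i) x)"
  have len: "length (image_columns \<Phi> Z) = length Z" by (simp add: image_columns_def)
  have c: "c \<in> carrier_vec (length Z)" by (simp add: c_def)
  have x_eq: "x = combination Z c"
    using orthonormal_expansion[OF ZZ] x(1) S by (simp add: combination_def c_def)
  have "combination (image_columns \<Phi> Z) c = \<Phi> *v combination Z c"
    by (simp add: combination_def image_columns_def matrix_vector_mult_scaleR
        linear_sum[OF matrix_vector_mul_linear])
  then have zero: "combination (image_columns \<Phi> Z) c = 0"
    using x x_eq by simp
  have "?G *\<^sub>v c = 0\<^sub>v (length Z)"
    using index_transpose_times_mult_vec[of c "image_columns \<Phi> Z" _ "image_columns \<Phi> Z"] c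
    by (intro eq_vecI) (simp_all add: len zero)
  moreover have "Determinant.det ?G \<noteq> 0"
    using pos by (auto simp: vol_def)
  ultimately have "c = 0\<^sub>v (length Z)"
    using det_0_iff_vec_prod_zero_field[of ?G "length Z"] c
    by (metis len transpose_times_carrier)
  then show ?thesis by (simp add: x_eq combination_def)
qed

text \<open>Preimages \<open>x\<close> and \<open>y\<close> of a common vector differ by an element
  of the sum with image 0, so \<open>x = y\<close> lies in \<open>X \<inter> Y\<close>. This makes
  the angles between the images positive.\<close>

lemma image_Int_trivial:
  fixes \<Phi> :: "real ^ 'n ^ 'm"
  assumes XY: "subspace X" "subspace Y" "X \<inter> Y = {0}"
    and inj: "\<And>z. z \<in> sum_subspace X Y \<Longrightarrow> \<Phi> *v z = 0 \<Longrightarrow> z = 0"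
  shows "(\<lambda>x. \<Phi> *v x) ` X \<inter> (\<lambda>x. \<Phi> *v x) ` Y = {0}"
proof
  show "(\<lambda>x. \<Phi> *v x) ` X \<inter> (\<lambda>x. \<Phi> *v x) ` Y \<subseteq> {0}"
  proof
    fix w assume "w \<in> (\<lambda>x. \<Phi> *v x) ` X \<inter> (\<lambda>x. \<Phi> *v x) ` Y"
    then obtain x y where xy: "x \<in> X" "y \<in> Y" "w = \<Phi> *v x" "w = \<Phi> *v y" by auto
    then have "x + - y \<in> sum_subspace X Y"
      using subspace_neg[OF XY(2)] unfolding sum_subspace_def by blast
    moreover have "\<Phi> *v (x + - y) = 0"
      using xy by (simp add: matrix_vector_mult_diff_distrib)
    ultimately have "x + - y = 0" by (rule inj)
    then have "x \<in> X \<inter> Y" using xy by auto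
    then show "w \<in> {0}" using XY(3) xy by auto
  qed
  have "\<Phi> *v 0 \<in> (\<lambda>x. \<Phi> *v x) ` X" "\<Phi> *v 0 \<in> (\<lambda>x. \<Phi> *v x) ` Y"
    using XY by (blast intro: subspace_0)+
  then show "{0} \<subseteq> (\<lambda>x. \<Phi> *v x) ` X \<inter> (\<lambda>x. \<Phi> *v x) ` Y" by simp
qed

section \<open>The embedding property for orthonormal bases\<close>

text \<open>For integers \<open>M \<ge> d\<close>, the expected log-volume of an \<open>M\<close> by
  \<open>d\<close> matrix with independent centred Gaussian entries of variance \<open>1/M\<close>:
  its squared volume is distributed as a product of independent chi-square variables with
  \<open>M - p + 1\<close> degrees of freedom, each divided by \<open>M\<close>.\<close>

definition gaussian_log_volume :: "real \<Rightarrow> nat \<Rightarrow> real" where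
  "gaussian_log_volume M d = 1/2 * (\<Sum>p = 1..d. Digamma ((M - real p + 1) / 2) + ln 2 - ln M)"

text \<open>The sum up to \<open>2 * k\<close> splits at \<open>k\<close>, and its upper half is
  reindexed by \<open>p + k\<close>. One of the two subtracted sums cancels the lower half; the
  logarithms cancel in the rest.\<close>

lemma gaussian_log_volume_double:
  "gaussian_log_volume M (2 * k) - 2 * gaussian_log_volume M k
    = 1/2 * (\<Sum>p = 1..k. Digamma ((M - real p - real k + 1) / 2) - Digamma ((M - real p + 1) / 2))"
proof -
  let ?a = "\<lambda>p. Digamma ((M - real p + 1) / 2) + ln 2 - ln M"
  have "(\<Sum>p = 1..2 * k. ?a p) = (\<Sum>p = 1..k. ?a p) + (\<Sum>p = k + 1..k + k. ?a p)"
    using sum.ub_add_nat[of 1 k ?a k] by (simp only: mult_2)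
  also have "(\<Sum>p = k + 1..k + k. ?a p) = (\<Sum>p = 1..k. ?a (p + k))"
    using sum.shift_bounds_cl_nat_ivl[of ?a 1 k k] by (simp add: add.commute)
  finally have "(\<Sum>p = 1..2 * k. ?a p) - 2 * (\<Sum>p = 1..k. ?a p)
      = (\<Sum>p = 1..k. ?a (p + k)) - (\<Sum>p = 1..k. ?a p)"
    by linarith
  also have "\<dots> = (\<Sum>p = 1..k. ?a (p + k) - ?a p)"
    by (rule sum_subtractf[symmetric])
  also have "\<dots> = (\<Sum>p = 1..k. Digamma ((M - real p - real k + 1) / 2) - Digamma ((M - real p + 1) / 2))"
    by (intro sum.cong refl) (simp add: algebra_simps)
  finally show ?thesis
    by (simp add: gaussian_log_volume_def algebra_simps)
qed

text \<open>Orthonormal vectors have norm 1 and volume \<open>1 > C\<close>, so the embedding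
  property applies with denominator 1. Dimension 0, where that property is not assumed, is included
  to cover \<open>k = 0\<close>.\<close>

lemma volume_preserving_embedding_orthonormal:
  fixes \<Phi> :: "real ^ 'n ^ 'm"
  assumes vpe: "d \<noteq> 0 \<Longrightarrow> volume_preserving_embedding \<Phi> W d C \<epsilon>" and "C < 1" "0 \<le> \<epsilon>"
    and Z: "orthonormal_basis Z S" "S \<subseteq> W" "length Z = d"
  shows "0 < vol (image_columns \<Phi> Z)"
    and "\<bar>ln (vol (image_columns \<Phi> Z)) - gaussian_log_volume CARD('m) d\<bar> \<le> \<epsilon>"
proof -
  have ZZ: "transpose_times Z Z = 1\<^sub>m (length Z)" and S: "span (set Z) = S"
    using Z by (auto simp: orthonormal_basis_def)
  have "0 < vol (image_columns \<Phi> Z)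
      \<and> \<bar>ln (vol (image_columns \<Phi> Z)) - gaussian_log_volume CARD('m) d\<bar> \<le> \<epsilon>"
  proof (cases "d = 0")
    \<comment> \<open>The empty Gram determinant is 1 and the sum is empty, so the bound reads
      \<open>0 \<le> \<epsilon>\<close>.\<close>
    case True
    moreover have "transpose_times ([] :: (real ^ 'm) list) [] = 1\<^sub>m 0"
      by (rule eq_matI) auto
    ultimately show ?thesis using Z assms(3) by (simp add: gaussian_log_volume_def image_columns_def vol_def)
  next
    case False
    have "\<forall>x\<in>set Z. norm x = 1" using norm_orthonormal[OF ZZ] by blast
    then show ?thesis
      using vpe[OF False] Z S vol_orthonormal[OF ZZ] \<open>C < 1\<close>
      unfolding volume_preserving_embedding_def gaussian_log_volume_def by force
  qed
  then show "0 < vol (image_columns \<Phi> Z)"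
    and "\<bar>ln (vol (image_columns \<Phi> Z)) - gaussian_log_volume CARD('m) d\<bar> \<le> \<epsilon>" by auto
qed

section \<open>Distortion of the product of sines\<close>

theorem theorem2:
  fixes X :: "nat \<Rightarrow> (real ^ 'n) set"
    and \<Phi> :: "real ^ 'n ^ 'm"
    and L k :: nat
    and C\<^sub>s \<epsilon> :: real
  assumes "\<And>i. i \<in> {1..L} \<Longrightarrow> subspace (X i) \<and> dim (X i) = k"
    and "\<And>i j. i \<in> {1..L} \<Longrightarrow> j \<in> {1..L} \<Longrightarrow> i \<noteq> j \<Longrightarrow> X i \<inter> X j = {0}"
    and "0 < C\<^sub>s" and "C\<^sub>s < 1" and "\<epsilon> > 0"
    and "2 * k \<le> CARD('m)" and "CARD('m) < CARD('n)"
    and "\<And>i. i \<in> {1..L} \<Longrightarrow> dim ((\<lambda>x. \<Phi> *v x) ` X i) = k"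
    and "\<And>d i j. d \<in> {1..2 * k} \<Longrightarrow> i \<in> {1..L} \<Longrightarrow> j \<in> {1..L} \<Longrightarrow> i \<noteq> j \<Longrightarrow>
           volume_preserving_embedding \<Phi> (sum_subspace (X i) (X j)) d C\<^sub>s \<epsilon>"
  shows "\<forall>i \<in> {1..L}. \<forall>j \<in> {1..L}. i \<noteq> j \<longrightarrow>
    (let \<theta> = (\<lambda>m. principal_angle m (X i) (X j));
         \<phi> = (\<lambda>m. principal_angle m ((\<lambda>x. \<Phi> *v x) ` X i) ((\<lambda>x. \<Phi> *v x) ` X j))
     in length (principal_angles (X i) (X j)) = k \<and>
        length (principal_angles ((\<lambda>x. \<Phi> *v x) ` X i) ((\<lambda>x. \<Phi> *v x) ` X j)) = k \<and>
        (\<forall>m \<in> {1..k}. 0 < \<theta> m \<and> \<theta> m \<le> pi / 2) \<and> antimono_on {1..k} \<theta> \<and>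
        (\<forall>m \<in> {1..k}. 0 < \<phi> m \<and> \<phi> m \<le> pi / 2) \<and> antimono_on {1..k} \<phi> \<and>
        \<bar>ln ((\<Prod>m = 1..k. sin (\<phi> m)) / (\<Prod>m = 1..k. sin (\<theta> m)))
           - 1/2 * (\<Sum>p = 1..k. Digamma ((real CARD('m) - real p - real k + 1) / 2)
                                 - Digamma ((real CARD('m) - real p + 1) / 2))\<bar> \<le> 3 * \<epsilon>)"
proof (intro ballI impI)
  fix i j assume i: "i \<in> {1..L}" and j: "j \<in> {1..L}" and "i \<noteq> j"
  let ?X = "X i" and ?Y = "X j"
  let ?\<Phi>X = "(\<lambda>x. \<Phi> *v x) ` ?X" and ?\<Phi>Y = "(\<lambda>x. \<Phi> *v x) ` ?Y"
  let ?W = "sum_subspace ?X ?Y"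
  let ?g = "gaussian_log_volume (real CARD('m))"
  have X: "subspace ?X" "dim ?X = k" and Y: "subspace ?Y" "dim ?Y = k"
    using assms(1) i j by auto
  have XY: "?X \<inter> ?Y = {0}" using assms(2) i j \<open>i \<noteq> j\<close> by blast
  have \<Phi>X: "subspace ?\<Phi>X" "dim ?\<Phi>X = k" and \<Phi>Y: "subspace ?\<Phi>Y" "dim ?\<Phi>Y = k"
    using assms(8) i j X Y by (auto intro!: linear_subspace_image)
  have vpe: "volume_preserving_embedding \<Phi> ?W d C\<^sub>s \<epsilon>" if "d \<noteq> 0" "d \<le> 2 * k" for d
    using assms(9)[of d i j] i j \<open>i \<noteq> j\<close> that by auto
  have XW: "?X \<subseteq> ?W" and YW: "?Y \<subseteq> ?W"
    using subspace_0[OF X(1)] subspace_0[OF Y(1)] unfolding sum_subspace_def by force+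
  have "subspace ?W"
    using subspace_sums[OF X(1) Y(1)] by (simp add: sum_subspace_def)
  then obtain Z where Z: "orthonormal_basis Z ?W"
    by (rule obtain_orthonormal_basis)
  have "length Z = 2 * k"
    using length_orthonormal_basis[OF Z] dim_sums_Int[OF X(1) Y(1)] X Y XY
    by (simp add: sum_subspace_def)
  note vol_Z = volume_preserving_embedding_orthonormal[OF vpe \<open>C\<^sub>s < 1\<close> less_imp_le[OF \<open>\<epsilon> > 0\<close>] Z
      order_refl this, simplified]
  \<comment> \<open>Positive volume of \<open>\<Phi> Z\<close> makes \<open>\<Phi>\<close> injective
    on the whole sum, not just on each summand.\<close>
  have \<Phi>XY: "?\<Phi>X \<inter> ?\<Phi>Y = {0}"
    using matrix_injective_if_vol_pos[OF Z vol_Z(1)] by (intro image_Int_trivial X Y XY) auto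
  obtain U V where U: "orthonormal_basis U ?X" and V: "orthonormal_basis V ?Y"
    and \<theta>: "length (principal_angles ?X ?Y) = k"
    "\<forall>m\<in>{1..k}. 0 < principal_angle m ?X ?Y \<and> principal_angle m ?X ?Y \<le> pi / 2"
    "antimono_on {1..k} (\<lambda>m. principal_angle m ?X ?Y)"
    and sin_\<theta>: "(\<Prod>m = 1..k. sin (principal_angle m ?X ?Y)) = vol (U @ V)" "0 < vol (U @ V)"
    using principal_angle_properties[OF X(1) Y(1) XY Y(2)] .
  obtain U' V' where U': "orthonormal_basis U' ?\<Phi>X" and V': "orthonormal_basis V' ?\<Phi>Y"
    and \<phi>: "length (principal_angles ?\<Phi>X ?\<Phi>Y) = k"
    "\<forall>m\<in>{1..k}. 0 < principal_angle m ?\<Phi>X ?\<Phi>Y \<and> principal_angle m ?\<Phi>X ?\<Phi>Y \<le> pi / 2"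
    "antimono_on {1..k} (\<lambda>m. principal_angle m ?\<Phi>X ?\<Phi>Y)"
    and sin_\<phi>: "(\<Prod>m = 1..k. sin (principal_angle m ?\<Phi>X ?\<Phi>Y)) = vol (U' @ V')" "0 < vol (U' @ V')"
    using principal_angle_properties[OF \<Phi>X(1) \<Phi>Y(1) \<Phi>XY \<Phi>Y(2)] .
  have lengths: "length U = k" "length V = k" "length U' = k" "length V' = k"
    using length_orthonormal_basis U V U' V' X Y \<Phi>X \<Phi>Y by metis+
  have sets: "set U \<subseteq> ?X" "set V \<subseteq> ?Y"
    using U V span_superset by (auto simp: orthonormal_basis_def)
  have k: "k \<le> 2 * k" by simp
  note vol_U = volume_preserving_embedding_orthonormal[OF vpe[OF _ k] \<open>C\<^sub>s < 1\<close>
      less_imp_le[OF \<open>\<epsilon> > 0\<close>] U XW lengths(1)]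
  note vol_V = volume_preserving_embedding_orthonormal[OF vpe[OF _ k] \<open>C\<^sub>s < 1\<close>
      less_imp_le[OF \<open>\<epsilon> > 0\<close>] V YW lengths(2)]
  \<comment> \<open>The volume of \<open>\<Phi> [U, V]\<close> is computed in two ways, first by the
    scaling factor of \<open>\<Phi>\<close> on the sum, however small \<open>vol (U @ V)\<close>
    is.\<close>
  have "vol (image_columns \<Phi> (U @ V)) = vol (image_columns \<Phi> Z) * vol (U @ V)"
    using sets XW YW lengths \<open>length Z = 2 * k\<close> by (intro vol_image_columns[OF Z]) auto
  \<comment> \<open>The lists \<open>\<Phi> U\<close> and \<open>\<Phi> V\<close> are bases of the
    images but in general not orthonormal, so their volumes enter next to
    \<open>vol (U' @ V')\<close>.\<close>
  moreover have "vol (image_columns \<Phi> (U @ V))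
      = vol (image_columns \<Phi> U) * vol (image_columns \<Phi> V) * vol (U' @ V')"
    using sets lengths vol_append[OF U' V', of "image_columns \<Phi> U" "image_columns \<Phi> V"]
    by (auto simp: image_columns_def)
  ultimately have "vol (U' @ V') / vol (U @ V)
      = vol (image_columns \<Phi> Z) / (vol (image_columns \<Phi> U) * vol (image_columns \<Phi> V))"
    using vol_U(1) vol_V(1) sin_\<theta>(2) by (simp add: field_simps)
  then have "ln (vol (U' @ V') / vol (U @ V))
      = ln (vol (image_columns \<Phi> Z)) - ln (vol (image_columns \<Phi> U)) - ln (vol (image_columns \<Phi> V))"
    using vol_Z(1) vol_U(1) vol_V(1) by (simp add: ln_div ln_mult)
  \<comment> \<open>One error of at most \<open>\<epsilon>\<close> comes from \<open>Z\<close> at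
    dimension \<open>2 * k\<close>, two more from \<open>U\<close> and \<open>V\<close> at dimension
    \<open>k\<close>.\<close>
  then have bound: "\<bar>ln (vol (U' @ V') / vol (U @ V)) - (?g (2 * k) - 2 * ?g k)\<bar> \<le> 3 * \<epsilon>"
    using vol_Z(2) vol_U(2) vol_V(2) by linarith
  show "let \<theta> = (\<lambda>m. principal_angle m ?X ?Y); \<phi> = (\<lambda>m. principal_angle m ?\<Phi>X ?\<Phi>Y)
     in length (principal_angles ?X ?Y) = k \<and> length (principal_angles ?\<Phi>X ?\<Phi>Y) = k \<and>
        (\<forall>m \<in> {1..k}. 0 < \<theta> m \<and> \<theta> m \<le> pi / 2) \<and> antimono_on {1..k} \<theta> \<and>
        (\<forall>m \<in> {1..k}. 0 < \<phi> m \<and> \<phi> m \<le> pi / 2) \<and> antimono_on {1..k} \<phi> \<and>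
        \<bar>ln ((\<Prod>m = 1..k. sin (\<phi> m)) / (\<Prod>m = 1..k. sin (\<theta> m)))
           - 1/2 * (\<Sum>p = 1..k. Digamma ((real CARD('m) - real p - real k + 1) / 2)
                                 - Digamma ((real CARD('m) - real p + 1) / 2))\<bar> \<le> 3 * \<epsilon>"
    unfolding Let_def sin_\<theta>(1) sin_\<phi>(1)
    by (intro conjI \<theta> \<phi> bound[unfolded gaussian_log_volume_double])
qed

end
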